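(* Let $\mathcal{K}$ be a set of polynomials with $\mathbb{R}_+ \subseteq \mathcal{K} \subset \mathbb{R}[x]$, $x=(x_1,\dots,x_n)$. Let $g_1,\dots,g_m \in \mathbb{R}[x]$ be such that $S=\{x\in \mathbb{R}^n: g_1(x)\ge 0,\dots,g_m(x)\ge 0\}$ is a non-empty compact set. Let $L,U \in \mathbb{R}^n$ be such that $S \subseteq \{x \in \mathbb{R}^n: L \le x \le U\}$. Let $p\in\mathbb{R}[x]$ satisfy $p(x)>0$ for all $x\in S$. Then there exist $r \ge 0$ and $c_{\alpha, \beta, \gamma} \in \mathcal{K}$ for $(\alpha, \beta,\gamma) \in \mathbb{N}^{2n+m}_{r}$ such that $$p(x) = \sum_{(\alpha, \beta,\gamma ) \in \mathbb{N}^{2n+m}_{r} } c_{\alpha, \beta,\gamma}(x)\, (x-L)^{\alpha} (U-x)^{\beta}g(x)^\gamma .$$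
   Context: $\mathbb{R}_+$ denotes the nonnegative reals, viewed as constant polynomials. Inequalities between vectors are componentwise. $\mathbb{N}$ includes $0$; $\mathbb{N}^{k}_r=\{\alpha\in\mathbb{N}^k:\sum_i\alpha_i\le r\}$. In $(\alpha,\beta,\gamma)\in\mathbb{N}^{2n+m}_r$ one has $\alpha,\beta\in\mathbb{N}^n$, $\gamma\in\mathbb{N}^m$. Multi-index powers: $(x-L)^\alpha=\prod_{i=1}^n(x_i-L_i)^{\alpha_i}$, $(U-x)^\beta=\prod_{i=1}^n(U_i-x_i)^{\beta_i}$, $g(x)^\gamma=\prod_{j=1}^m g_j(x)^{\gamma_j}$. *)

theory Defs
  imports "HOL-Analysis.Analysis" "HOL-Library.Poly_Mapping"
begin

text \<open>
  Real polynomials in finitely many variables indexed by \<open>'n\<close>, as finitely supported maps from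
  monomials (finitely supported exponent vectors) to coefficients. The ring operations are those
  of \<^theory>\<open>HOL-Library.Poly_Mapping\<close>, whose product is the convolution product.
\<close>

type_synonym 'n rpoly = "('n \<Rightarrow>\<^sub>0 nat) \<Rightarrow>\<^sub>0 real"

definition Const :: "real \<Rightarrow> 'n rpoly"
  where "Const c = Poly_Mapping.single 0 c"

definition Var :: "'n \<Rightarrow> 'n rpoly"
  where "Var i = Poly_Mapping.single (Poly_Mapping.single i 1) 1"

definition peval :: "'n::finite rpoly \<Rightarrow> real ^ 'n \<Rightarrow> real"
  where "peval p x =
    (\<Sum>\<mu>\<in>Poly_Mapping.keys p. Poly_Mapping.lookup p \<mu> * (\<Prod>i\<in>UNIV. (x $ i) ^ Poly_Mapping.lookup \<mu> i))"

definition mpow :: "('k::finite \<Rightarrow> 'n rpoly) \<Rightarrow> nat ^ 'k \<Rightarrow> 'n rpoly"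
  where "mpow f \<alpha> = (\<Prod>i\<in>UNIV. f i ^ (\<alpha> $ i))"

definition exponents :: "nat \<Rightarrow> ((nat ^ 'n) \<times> (nat ^ 'n) \<times> (nat ^ 'm)) set"
  where "exponents r =
    {(\<alpha>, \<beta>, \<gamma>). (\<Sum>i\<in>UNIV. \<alpha> $ i) + (\<Sum>i\<in>UNIV. \<beta> $ i) + (\<Sum>j\<in>UNIV. \<gamma> $ j) \<le> r}"

definition feasible_set :: "('m \<Rightarrow> 'n::finite rpoly) \<Rightarrow> (real ^ 'n) set"
  where "feasible_set g = {x. \<forall>j. peval (g j) x \<ge> 0}"

lemma finite_bounded_exponents: "finite {\<alpha> :: nat ^ 'k::finite. (\<Sum>i\<in>UNIV. \<alpha> $ i) \<le> r}"
proof (rule finite_subset)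
  show "{\<alpha> :: nat ^ 'k. (\<Sum>i\<in>UNIV. \<alpha> $ i) \<le> r} \<subseteq> vec_lambda ` (PiE UNIV (\<lambda>_. {..r}))"
  proof
    fix \<alpha> :: "nat ^ 'k" assume "\<alpha> \<in> {\<alpha>. (\<Sum>i\<in>UNIV. \<alpha> $ i) \<le> r}"
    then have "\<alpha> $ i \<le> r" for i
      using member_le_sum[of i UNIV "\<lambda>i. \<alpha> $ i"] by auto
    then show "\<alpha> \<in> vec_lambda ` (PiE UNIV (\<lambda>_. {..r}))"
      by (intro image_eqI[of _ _ "\<lambda>i. \<alpha> $ i"]) auto
  qed
  show "finite (vec_lambda ` (PiE (UNIV :: 'k set) (\<lambda>_. {..r})))"
    by (intro finite_imageI finite_PiE) auto
qed

lemma finite_exponents: "finite (exponents r :: ((nat ^ 'n::finite) \<times> (nat ^ 'n) \<times> (nat ^ 'm::finite)) set)"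
  by (rule finite_subset[OF _ finite_cartesian_product[OF finite_bounded_exponents[of r]
        finite_cartesian_product[OF finite_bounded_exponents[of r] finite_bounded_exponents[of r]]]])
    (auto simp: exponents_def)

lemma peval_Const: "peval (Const c) x = c"
  by (simp add: peval_def Const_def)

lemma peval_Var: "peval (Var i) x = x $ i"
proof -
  have "(\<Prod>j\<in>UNIV. (x $ j) ^ Poly_Mapping.lookup (Poly_Mapping.single i 1) j) =
      (\<Prod>j\<in>UNIV. if j = i then x $ j else 1)"
    by (intro prod.cong) (auto simp: lookup_single when_def)
  then show ?thesis
    by (simp add: peval_def Var_def)
qed

end

theory Submission
  imports Defs
begin

text \<open>
  Let \<open>T\<close> be the preprime (the set closed under sums and products) generated by the nonnegative
  constants, the linear polynomials \<open>x\<^sub>i - L\<^sub>i\<close> and \<open>U\<^sub>i - x\<^sub>i\<close>, and the constraints \<open>g\<^sub>j\<close>. Multiplying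
  out shows that an element of \<open>T\<close> is a combination of the products
  \<open>(x - L)\<^sup>\<alpha> (U - x)\<^sup>\<beta> g\<^sup>\<gamma>\<close> with nonnegative constant coefficients, and such constants lie in \<open>\<K>\<close>.
  So it suffices to prove \<open>p \<in> T\<close>. Two classical approximation theorems achieve this.

  The first one is due to Bernstein: if \<open>q\<close> is positive on a box \<open>[l, h]\<close> with nonempty interior, then
  all coefficients of \<open>q\<close> in the Bernstein basis of the box are nonnegative once the degree \<open>N\<close> of
  the basis is large, because the coefficient with index \<open>\<kappa>\<close> is close to the value of \<open>q\<close> at the grid
  point with relative coordinates \<open>\<kappa>\<^sub>i / N\<close>. Since the basis polynomials are products of \<open>x\<^sub>i - l\<^sub>i\<close>
  and \<open>h\<^sub>i - x\<^sub>i\<close>, this puts \<open>q\<close> into \<open>T\<close> (\<open>preprime_if_pos_on_box\<close>). The box used is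
  \<open>[L - 1, U + 1]\<close>: it has interior even when \<open>L\<^sub>i = U\<^sub>i\<close> for some \<open>i\<close>, and its linear
  polynomials differ from the given ones by the constant 1, hence are in \<open>T\<close>.

  The second one is the theorem of Stone and Weierstrass, which reduces the problem to the box. Put
  \<open>g\<^sub>j\<^sup>- = max 0 (- g\<^sub>j)\<close>. The function \<open>\<Sum>\<^sub>j (g\<^sub>j\<^sup>-)\<^sup>2\<close> vanishes only on the feasible set, where \<open>p\<close> is positive,
  so \<open>p + M \<Sum>\<^sub>j (g\<^sub>j\<^sup>-)\<^sup>2\<close> is positive on the whole box for a suitable constant \<open>M\<close>. As
  \<open>(g\<^sub>j\<^sup>-)\<^sup>2 = - g\<^sub>j\<^sup>- g\<^sub>j\<close>, this function is \<open>p - \<Sum>\<^sub>j (M g\<^sub>j\<^sup>-) g\<^sub>j\<close>. Adding a small positive constant to the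
  multipliers \<open>M g\<^sub>j\<^sup>-\<close> and approximating them by polynomials \<open>m\<^sub>j\<close> keeps both the multipliers and the
  difference positive on the box (\<open>exists_positive_multipliers\<close>). Hence \<open>m\<^sub>j\<close> and
  \<open>p - \<Sum>\<^sub>j m\<^sub>j g\<^sub>j\<close> are in \<open>T\<close> by the first step, and therefore so is \<open>p\<close>.
\<close>

section \<open>The polynomial ring and evaluation\<close>

lemma Const_0 [simp]: "Const 0 = 0"
  and Const_1 [simp]: "Const 1 = 1"
  by (simp_all add: Const_def)

lemma Const_add: "Const (a + b) = Const a + Const b"
  by (simp add: Const_def single_add)

lemma Const_diff: "Const (a - b) = Const a - Const b"
  by (simp add: Const_def single_diff)

lemma Const_mult: "Const (a * b) = Const a * Const b"
  by (simp add: Const_def mult_single)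

lemma Const_sum: "Const (sum f A) = (\<Sum>a\<in>A. Const (f a))"
  by (induction A rule: infinite_finite_induct) (simp_all add: Const_add)

lemma Const_prod: "Const (prod f A) = (\<Prod>a\<in>A. Const (f a))"
  by (induction A rule: infinite_finite_induct) (simp_all add: Const_mult)

lemma Const_power: "Const (a ^ k) = Const a ^ k"
  by (induction k) (simp_all add: Const_mult)

lemma Const_of_nat: "Const (of_nat k) = of_nat k"
  by (induction k) (simp_all add: Const_add)

lemma Var_power: "Var i ^ k = Poly_Mapping.single (Poly_Mapping.single i k) 1"
  by (induction k) (simp_all add: Var_def mult_single flip: single_add)

lemma prod_Var_power:
  fixes \<mu> :: "'n::finite \<Rightarrow>\<^sub>0 nat"
  shows "(\<Prod>i\<in>UNIV. Var i ^ Poly_Mapping.lookup \<mu> i) = Poly_Mapping.single \<mu> 1"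
proof -
  have "(\<Prod>i\<in>A. Var i ^ Poly_Mapping.lookup \<mu> i) =
      Poly_Mapping.single (\<Sum>i\<in>A. Poly_Mapping.single i (Poly_Mapping.lookup \<mu> i)) 1"
    if "finite A" for A
    using that by (induction A) (simp_all add: Var_power mult_single)
  moreover have "(\<Sum>i\<in>UNIV. Poly_Mapping.single i (Poly_Mapping.lookup \<mu> i)) = \<mu>"
    by (rule poly_mapping_eqI) (simp add: lookup_sum lookup_single when_def)
  ultimately show ?thesis
    by simp
qed

lemma poly_eq_sum_monomials:
  fixes q :: "'n::finite rpoly"
  shows "q = (\<Sum>\<mu>\<in>Poly_Mapping.keys q.
    Const (Poly_Mapping.lookup q \<mu>) * (\<Prod>i\<in>UNIV. Var i ^ Poly_Mapping.lookup \<mu> i))"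
  by (rule poly_mapping_eqI)
    (auto simp: prod_Var_power Const_def mult_single lookup_sum lookup_single when_def in_keys_iff)

lemma peval_superset:
  assumes "finite A" "Poly_Mapping.keys q \<subseteq> A"
  shows "peval q x = (\<Sum>\<mu>\<in>A. Poly_Mapping.lookup q \<mu> *
    (\<Prod>i\<in>UNIV. (x $ i) ^ Poly_Mapping.lookup \<mu> i))"
  unfolding peval_def using assms by (intro sum.mono_neutral_left) (auto simp: in_keys_iff)

lemma peval_single:
  "peval (Poly_Mapping.single \<mu> c) x = c * (\<Prod>i\<in>UNIV. (x $ i) ^ Poly_Mapping.lookup \<mu> i)"
  by (subst peval_superset[where A = "{\<mu>}"]) simp_all

lemma peval_add: "peval (p + q) x = peval p x + peval q x"
proof -
  let ?A = "Poly_Mapping.keys p \<union> Poly_Mapping.keys q"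
  have "Poly_Mapping.keys (p + q) \<subseteq> ?A"
    by (rule Poly_Mapping.keys_add)
  then show ?thesis
    by (simp add: peval_superset[where A = ?A] lookup_add distrib_right sum.distrib)
qed

lemma peval_0 [simp]: "peval 0 x = 0"
  by (simp add: peval_def)

lemma peval_sum: "peval (sum f A) x = (\<Sum>a\<in>A. peval (f a) x)"
  by (induction A rule: infinite_finite_induct) (simp_all add: peval_add)

lemma peval_mult: "peval (p * q) x = peval p x * peval q x"
proof -
  define s where "s r \<mu> = Poly_Mapping.single \<mu> (Poly_Mapping.lookup r \<mu>)" for r :: "'a rpoly" and \<mu>
  have decomp: "r = (\<Sum>\<mu>\<in>Poly_Mapping.keys r. s r \<mu>)" for r
    by (rule poly_mapping_eqI) (auto simp: s_def lookup_sum lookup_single when_def in_keys_iff)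
  have "peval (s p \<mu> * s q \<nu>) x = peval (s p \<mu>) x * peval (s q \<nu>) x" for \<mu> \<nu>
    by (simp add: s_def mult_single peval_single lookup_add power_add prod.distrib algebra_simps)
  then have "peval ((\<Sum>\<mu>\<in>Poly_Mapping.keys p. s p \<mu>) * (\<Sum>\<nu>\<in>Poly_Mapping.keys q. s q \<nu>)) x =
      peval (\<Sum>\<mu>\<in>Poly_Mapping.keys p. s p \<mu>) x * peval (\<Sum>\<nu>\<in>Poly_Mapping.keys q. s q \<nu>) x"
    by (simp add: sum_product peval_sum)
  then show ?thesis
    by (simp flip: decomp)
qed

lemma peval_diff: "peval (p - q) x = peval p x - peval q x"
  using peval_add[of "p - q" q x] by simp

lemma continuous_on_peval [continuous_intros]: "continuous_on A (peval q)"
  unfolding peval_def by (intro continuous_intros)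

lemma real_polynomial_function_eq_peval:
  assumes "real_polynomial_function f"
  shows "\<exists>q. f = peval q"
  using assms
proof induction
  case (linear f)
  interpret bounded_linear f by fact
  have "f x = peval (\<Sum>i\<in>UNIV. Const (f (axis i 1)) * Var i) x" for x
  proof -
    have "f x = f (\<Sum>i\<in>UNIV. (x $ i) *\<^sub>R axis i 1)"
      using basis_expansion[of x] by (simp add: scalar_mult_eq_scaleR)
    then show ?thesis
      by (simp add: sum scaleR peval_sum peval_mult peval_Const peval_Var mult.commute)
  qed
  then show ?case by blast
next
  case (const c)
  have "(\<lambda>x. c) = peval (Const c)"
    by (simp add: fun_eq_iff peval_Const)
  then show ?case by blast
next
  case (add f g)
  then obtain q q' where "f = peval q" "g = peval q'" by blast
  then show ?case by (intro exI[of _ "q + q'"]) (simp add: fun_eq_iff peval_add)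
next
  case (mult f g)
  then obtain q q' where "f = peval q" "g = peval q'" by blast
  then show ?case by (intro exI[of _ "q * q'"]) (simp add: fun_eq_iff peval_mult)
qed

section \<open>Preprimes\<close>

text \<open>
  Squares are not required to belong to the set: it is a subsemiring containing the nonnegative
  constants, in general smaller than the preordering generated by \<open>G\<close>.
\<close>

inductive_set preprime :: "'n::finite rpoly set \<Rightarrow> 'n rpoly set" for G where
  Const: "0 \<le> c \<Longrightarrow> Const c \<in> preprime G"
| gen: "q \<in> G \<Longrightarrow> q \<in> preprime G"
| add: "q \<in> preprime G \<Longrightarrow> q' \<in> preprime G \<Longrightarrow> q + q' \<in> preprime G"
| mult: "q \<in> preprime G \<Longrightarrow> q' \<in> preprime G \<Longrightarrow> q * q' \<in> preprime G"

lemma preprime_0: "0 \<in> preprime G" and preprime_1: "1 \<in> preprime G"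
  using preprime.Const[of 0 G] preprime.Const[of 1 G] by simp_all

lemma preprime_sum: "(\<And>a. a \<in> A \<Longrightarrow> f a \<in> preprime G) \<Longrightarrow> sum f A \<in> preprime G"
  by (induction A rule: infinite_finite_induct) (auto intro: preprime.intros preprime_0)

lemma preprime_prod: "(\<And>a. a \<in> A \<Longrightarrow> f a \<in> preprime G) \<Longrightarrow> prod f A \<in> preprime G"
  by (induction A rule: infinite_finite_induct) (auto intro: preprime.intros preprime_1)

lemma preprime_power: "q \<in> preprime G \<Longrightarrow> q ^ k \<in> preprime G"
  by (induction k) (auto intro: preprime.intros preprime_1)

section \<open>Bernstein expansions\<close>

text \<open>
  This is \<open>k (k - 1) \<dots> (k - m + 1) / (N (N - 1) \<dots> (N - m + 1))\<close>, the coefficient of the power \<open>u\<^sup>m\<close> with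
  respect to \<open>(N choose k) u\<^sup>k (1 - u)\<^sup>N\<^sup>-\<^sup>k\<close>. With the truncated subtraction the numerator vanishes for
  \<open>k < m\<close>, as it should, while every single factor stays close to \<open>k / N\<close>.
\<close>

definition falling_ratio :: "nat \<Rightarrow> nat \<Rightarrow> nat \<Rightarrow> real"
  where "falling_ratio N m k = (\<Prod>j<m. real (k - j) / real (N - j))"

lemma binomial_mult_falling_ratio_Suc:
  "real (Suc N choose Suc k) * falling_ratio (Suc N) (Suc m) (Suc k) =
    real (N choose k) * falling_ratio N m k"
proof -
  have "real (Suc k) * real (Suc N choose Suc k) = real (Suc N) * real (N choose k)"
    by (metis Suc_times_binomial of_nat_mult)
  then have "real (Suc N choose Suc k) * (real (Suc k) / real (Suc N)) = real (N choose k)"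
    by (simp add: field_simps del: binomial_Suc_Suc)
  moreover have "falling_ratio (Suc N) (Suc m) (Suc k) =
      (real (Suc k) / real (Suc N)) * falling_ratio N m k"
    by (simp add: falling_ratio_def prod.lessThan_Suc_shift del: prod.lessThan_Suc)
  ultimately show ?thesis
    by (metis mult.assoc)
qed

text \<open>
  For \<open>m = 0\<close> this expands \<open>1 = (u + v)\<^sup>N\<close>. Multiplying the expansion of degree \<open>N\<close> by \<open>u\<close> shifts the index,
  and \<open>binomial_mult_falling_ratio_Suc\<close> says that the coefficients shift with it.
\<close>

lemma power_Bernstein_expansion:
  fixes u v :: "'n rpoly"
  assumes "u + v = 1" and "m \<le> N"
  shows "u ^ m = (\<Sum>k\<le>N. Const (real (N choose k) * falling_ratio N m k) * (u ^ k * v ^ (N - k)))"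
  using assms(2)
proof (induction m arbitrary: N)
  case 0
  have "1 = (u + v) ^ N"
    using assms(1) by simp
  then show ?case
    by (simp add: falling_ratio_def binomial_ring Const_of_nat algebra_simps)
next
  case (Suc m)
  then obtain N' where N: "N = Suc N'" and "m \<le> N'"
    by (cases N) auto
  have "(\<Sum>k\<le>N. Const (real (N choose k) * falling_ratio N (Suc m) k) * (u ^ k * v ^ (N - k))) =
      (\<Sum>k\<le>N'. Const (real (N choose Suc k) * falling_ratio N (Suc m) (Suc k)) *
        (u ^ Suc k * v ^ (N - Suc k)))"
    unfolding N by (subst sum.atMost_Suc_shift)
      (simp add: falling_ratio_def prod.lessThan_Suc_shift del: prod.lessThan_Suc)
  also have "\<dots> = u * (\<Sum>k\<le>N'. Const (real (N' choose k) * falling_ratio N' m k) * (u ^ k * v ^ (N' - k)))"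
    unfolding N binomial_mult_falling_ratio_Suc by (simp add: sum_distrib_left algebra_simps)
  also have "\<dots> = u ^ Suc m"
    by (simp flip: Suc.IH[OF \<open>m \<le> N'\<close>])
  finally show ?case ..
qed

text \<open>
  The coefficients of \<open>(l + w u)\<^sup>m\<close>, obtained from those of the powers of \<open>u\<close> by the binomial theorem.
\<close>

definition Bernstein_coeff :: "real \<Rightarrow> real \<Rightarrow> nat \<Rightarrow> nat \<Rightarrow> nat \<Rightarrow> real"
  where "Bernstein_coeff l w N m k =
    (\<Sum>j\<le>m. real (m choose j) * l ^ (m - j) * w ^ j * falling_ratio N j k)"

lemma affine_power_Bernstein_expansion:
  fixes u v :: "'n rpoly"
  assumes "u + v = 1" and "m \<le> N"
  shows "(Const l + Const w * u) ^ m =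
    (\<Sum>k\<le>N. Const (Bernstein_coeff l w N m k) *
      (Const (real (N choose k)) * u ^ k * v ^ (N - k)))"
proof -
  have "(Const l + Const w * u) ^ m = (Const w * u + Const l) ^ m"
    by (simp only: add.commute)
  also have "\<dots> = (\<Sum>j\<le>m. Const (real (m choose j) * l ^ (m - j) * w ^ j) * u ^ j)"
    unfolding binomial_ring
    by (simp add: Const_mult Const_power Const_of_nat power_mult_distrib mult_ac)
  also have "\<dots> = (\<Sum>j\<le>m. Const (real (m choose j) * l ^ (m - j) * w ^ j) *
      (\<Sum>k\<le>N. Const (real (N choose k) * falling_ratio N j k) * (u ^ k * v ^ (N - k))))"
    using assms power_Bernstein_expansion[of u v _ N] by (intro sum.cong) auto
  also have "\<dots> = (\<Sum>k\<le>N. \<Sum>j\<le>m. Const (real (m choose j) * l ^ (m - j) * w ^ j * falling_ratio N j k) *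
      (Const (real (N choose k)) * u ^ k * v ^ (N - k)))"
    by (subst sum.swap) (simp add: sum_distrib_left Const_mult algebra_simps)
  finally show ?thesis
    by (simp add: Bernstein_coeff_def Const_sum sum_distrib_right)
qed

text \<open>
  For \<open>j \<le> k\<close> the difference is exactly \<open>j (N - k) / (N (N - j))\<close>, and \<open>N - k \<le> N - j\<close>;
  for \<open>k < j\<close> the first fraction is zero and the second is below \<open>j / N\<close>.
\<close>

lemma falling_ratio_factor_diff:
  assumes "k \<le> N" "j < N"
  shows "\<bar>real (k - j) / real (N - j) - real k / real N\<bar> \<le> real j / real N"
proof (cases "j \<le> k")
  case True
  then have "real k / real N - real (k - j) / real (N - j) =
      (real j / real N) * (real (N - k) / real (N - j))"
    using assms by (simp add: of_nat_diff divide_simps) (simp add: algebra_simps)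
  moreover have "0 \<le> real (N - k) / real (N - j)" "real (N - k) / real (N - j) \<le> 1"
    using True assms by (auto simp: divide_simps)
  ultimately show ?thesis
    by (smt (verit) mult_left_le mult_nonneg_nonneg divide_nonneg_nonneg of_nat_0_le_iff)
next
  case False
  then show ?thesis
    using assms by (simp add: divide_right_mono)
qed

lemma tendsto_falling_ratio:
  fixes N k :: "nat \<Rightarrow> nat"
  assumes N: "filterlim N at_top sequentially" and k: "\<And>n. k n \<le> N n"
    and t: "(\<lambda>n. real (k n) / real (N n)) \<longlonglongrightarrow> t"
  shows "(\<lambda>n. falling_ratio (N n) m (k n)) \<longlonglongrightarrow> t ^ m"
proof -
  have "(\<lambda>n. real (k n - j) / real (N n - j)) \<longlonglongrightarrow> t" for j
  proof -
    have "(\<lambda>n. real j / real (N n)) \<longlonglongrightarrow> 0"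
      by (intro tendsto_divide_0[OF tendsto_const] filterlim_at_top_imp_at_infinity
        filterlim_compose[OF filterlim_real_sequentially N])
    moreover have "\<forall>\<^sub>F n in sequentially.
        norm (real (k n - j) / real (N n - j) - real (k n) / real (N n)) \<le> real j / real (N n)"
      using eventually_compose_filterlim[OF eventually_gt_at_top[of j] N]
      by eventually_elim (use k falling_ratio_factor_diff in auto)
    ultimately have
      "(\<lambda>n. real (k n - j) / real (N n - j) - real (k n) / real (N n)) \<longlonglongrightarrow> 0"
      by (rule Lim_null_comparison[rotated])
    from tendsto_add[OF this t] show ?thesis
      by simp
  qed
  then have "(\<lambda>n. \<Prod>j<m. real (k n - j) / real (N n - j)) \<longlonglongrightarrow> (\<Prod>j<m. t)"
    by (intro tendsto_prod)
  then show ?thesis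
    by (simp add: falling_ratio_def)
qed

text \<open>
  The coefficient with index \<open>k\<close> approximates the value of \<open>(l + w u)\<^sup>m\<close> at \<open>u = k / N\<close>. The
  formulation along sequences of indices fits the compactness argument in
  \<open>box_Bernstein_coeff_nonneg\<close>, which then needs no uniform error bounds.
\<close>

lemma tendsto_Bernstein_coeff:
  fixes N k :: "nat \<Rightarrow> nat"
  assumes "filterlim N at_top sequentially" and "\<And>n. k n \<le> N n"
    and "(\<lambda>n. real (k n) / real (N n)) \<longlonglongrightarrow> t"
  shows "(\<lambda>n. Bernstein_coeff l w (N n) m (k n)) \<longlonglongrightarrow> (l + w * t) ^ m"
proof -
  have "(\<lambda>n. Bernstein_coeff l w (N n) m (k n)) \<longlonglongrightarrow>
      (\<Sum>j\<le>m. real (m choose j) * l ^ (m - j) * w ^ j * t ^ j)"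
    unfolding Bernstein_coeff_def by (intro tendsto_intros tendsto_falling_ratio assms)
  also have "(\<Sum>j\<le>m. real (m choose j) * l ^ (m - j) * w ^ j * t ^ j) = (w * t + l) ^ m"
    unfolding binomial_ring by (simp add: power_mult_distrib mult_ac)
  finally show ?thesis
    by (simp add: add.commute)
qed

definition box_Bernstein_coeff ::
  "real ^ 'n \<Rightarrow> real ^ 'n \<Rightarrow> 'n::finite rpoly \<Rightarrow> nat \<Rightarrow> ('n \<Rightarrow> nat) \<Rightarrow> real"
  where "box_Bernstein_coeff l h q N \<kappa> =
    (\<Sum>\<mu>\<in>Poly_Mapping.keys q. Poly_Mapping.lookup q \<mu> *
      (\<Prod>i\<in>UNIV. Bernstein_coeff (l $ i) (h $ i - l $ i) N (Poly_Mapping.lookup \<mu> i) (\<kappa> i)))"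

text \<open>
  Here \<open>u i\<close> is the \<open>i\<close>th coordinate rescaled from the box to the unit interval. Each monomial is a
  product of powers of single coordinates, so its expansion is the product of univariate ones.
\<close>

lemma box_Bernstein_expansion:
  fixes l h :: "real ^ 'n::finite" and q :: "'n rpoly" and u v :: "'n \<Rightarrow> 'n rpoly"
  assumes uv: "\<And>i. u i + v i = 1"
    and Var: "\<And>i. Var i = Const (l $ i) + Const (h $ i - l $ i) * u i"
    and N: "\<And>\<mu> i. \<mu> \<in> Poly_Mapping.keys q \<Longrightarrow> Poly_Mapping.lookup \<mu> i \<le> N"
  shows "q = (\<Sum>\<kappa>\<in>UNIV \<rightarrow>\<^sub>E {..N}. Const (box_Bernstein_coeff l h q N \<kappa>) *
    (\<Prod>i\<in>UNIV. Const (real (N choose \<kappa> i)) * u i ^ \<kappa> i * v i ^ (N - \<kappa> i)))"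
    (is "q = (\<Sum>\<kappa>\<in>?K. _ * (\<Prod>i\<in>UNIV. ?b i (\<kappa> i)))")
proof -
  let ?c = "\<lambda>\<mu> i. Bernstein_coeff (l $ i) (h $ i - l $ i) N (Poly_Mapping.lookup \<mu> i)"
  have "(\<Prod>i\<in>UNIV. Var i ^ Poly_Mapping.lookup \<mu> i) =
      (\<Sum>\<kappa>\<in>?K. Const (\<Prod>i\<in>UNIV. ?c \<mu> i (\<kappa> i)) * (\<Prod>i\<in>UNIV. ?b i (\<kappa> i)))"
    if "\<mu> \<in> Poly_Mapping.keys q" for \<mu>
  proof -
    have "(\<Prod>i\<in>UNIV. Var i ^ Poly_Mapping.lookup \<mu> i) =
        (\<Prod>i\<in>UNIV. \<Sum>k\<le>N. Const (?c \<mu> i k) * ?b i k)"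
      using affine_power_Bernstein_expansion[OF uv N[OF that]] by (simp only: Var)
    also have "\<dots> = (\<Sum>\<kappa>\<in>?K. \<Prod>i\<in>UNIV. Const (?c \<mu> i (\<kappa> i)) * ?b i (\<kappa> i))"
      by (intro prod_sum_PiE) auto
    finally show ?thesis
      by (simp add: Const_prod prod.distrib)
  qed
  then have "q = (\<Sum>\<mu>\<in>Poly_Mapping.keys q. Const (Poly_Mapping.lookup q \<mu>) *
      (\<Sum>\<kappa>\<in>?K. Const (\<Prod>i\<in>UNIV. ?c \<mu> i (\<kappa> i)) * (\<Prod>i\<in>UNIV. ?b i (\<kappa> i))))"
    by (subst poly_eq_sum_monomials[of q]) (intro sum.cong, auto)
  also have "\<dots> = (\<Sum>\<kappa>\<in>?K. \<Sum>\<mu>\<in>Poly_Mapping.keys q. Const (Poly_Mapping.lookup q \<mu> *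
      (\<Prod>i\<in>UNIV. ?c \<mu> i (\<kappa> i))) * (\<Prod>i\<in>UNIV. ?b i (\<kappa> i)))"
    by (subst sum.swap) (simp add: sum_distrib_left Const_mult mult.assoc)
  finally show ?thesis
    by (simp add: box_Bernstein_coeff_def Const_sum sum_distrib_right)
qed

text \<open>
  Otherwise there are negative coefficients for all large \<open>N\<close>. The relative grid points \<open>\<kappa> / N\<close> of
  their indices accumulate in the unit cube; along a convergent subsequence the coefficients tend to
  the value of \<open>q\<close> at the limit point, which would then be at most zero.
\<close>

lemma box_Bernstein_coeff_nonneg:
  fixes l h :: "real ^ 'n::finite" and q :: "'n rpoly"
  assumes "\<And>i. l $ i \<le> h $ i" and pos: "\<And>x. x \<in> cbox l h \<Longrightarrow> 0 < peval q x"
  shows "\<exists>N\<ge>N0. \<forall>\<kappa>. (\<forall>i. \<kappa> i \<le> N) \<longrightarrow> 0 \<le> box_Bernstein_coeff l h q N \<kappa>"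
proof (rule ccontr)
  assume "\<not> ?thesis"
  then have "\<exists>\<kappa>. (\<forall>i. \<kappa> i \<le> N0 + n) \<and> box_Bernstein_coeff l h q (N0 + n) \<kappa> < 0" for n
    by (meson le_add1 not_le)
  then obtain \<kappa> where \<kappa>: "\<And>n i. \<kappa> n i \<le> N0 + n"
    and neg: "\<And>n. box_Bernstein_coeff l h q (N0 + n) (\<kappa> n) < 0"
    by metis
  define t :: "nat \<Rightarrow> real ^ 'n" where "t n = (\<chi> i. real (\<kappa> n i) / real (N0 + n))" for n
  have "t n \<in> cbox 0 1" for n
    using \<kappa> by (auto simp: t_def mem_box_cart divide_le_eq_1 simp flip: of_nat_add)
  then obtain t' s where t': "t' \<in> cbox 0 1" and "strict_mono s" and lim: "(t \<circ> s) \<longlonglongrightarrow> t'"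
    using compact_cbox[of 0 1, unfolded compact_def] by metis
  define x where "x = (\<chi> i. l $ i + (h $ i - l $ i) * t' $ i)"
  have "x \<in> cbox l h"
    using t' assms(1) by (auto simp: x_def mem_box_cart mult_left_le
        intro: mult_nonneg_nonneg) (smt (verit) mult_left_le)
  have s: "filterlim (\<lambda>n. N0 + s n) at_top sequentially"
    by (rule filterlim_at_top_mono[OF filterlim_subseq[OF \<open>strict_mono s\<close>]]) simp
  have "(\<lambda>n. Bernstein_coeff (l $ i) (h $ i - l $ i) (N0 + s n) m (\<kappa> (s n) i)) \<longlonglongrightarrow> (x $ i) ^ m" for i m
  proof -
    have "(\<lambda>n. real (\<kappa> (s n) i) / real (N0 + s n)) \<longlonglongrightarrow> t' $ i"
      using tendsto_vec_nth[OF lim, of i] by (simp add: t_def o_def)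
    from tendsto_Bernstein_coeff[OF s \<kappa> this] show ?thesis
      by (simp add: x_def)
  qed
  then have "(\<lambda>n. box_Bernstein_coeff l h q (N0 + s n) (\<kappa> (s n))) \<longlonglongrightarrow> peval q x"
    unfolding box_Bernstein_coeff_def peval_def by (intro tendsto_intros)
  then have "peval q x \<le> 0"
    by (rule tendsto_upperbound) (simp_all add: neg less_imp_le)
  with pos[OF \<open>x \<in> cbox l h\<close>] show False
    by simp
qed

text \<open>
  A version of Handelman's theorem for boxes; strictness of \<open>l $ i < h $ i\<close> is what allows the
  rescaling to the unit cube.
\<close>

lemma preprime_if_pos_on_box:
  fixes l h :: "real ^ 'n::finite" and q :: "'n rpoly"
  assumes lh: "\<And>i. l $ i < h $ i"
    and lower: "\<And>i. Var i - Const (l $ i) \<in> preprime G"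
    and upper: "\<And>i. Const (h $ i) - Var i \<in> preprime G"
    and pos: "\<And>x. x \<in> cbox l h \<Longrightarrow> 0 < peval q x"
  shows "q \<in> preprime G"
proof -
  define u where "u i = Const (1 / (h $ i - l $ i)) * (Var i - Const (l $ i))" for i
  define v where "v i = Const (1 / (h $ i - l $ i)) * (Const (h $ i) - Var i)" for i
  have nz: "h $ i - l $ i \<noteq> 0" for i
    using lh[of i] by simp
  have "u i + v i = Const (1 / (h $ i - l $ i)) * Const (h $ i - l $ i)" for i
    by (simp add: u_def v_def Const_diff algebra_simps)
  then have uv: "u i + v i = 1" for i
    using nz[of i] by (simp flip: Const_mult)
  have "Const (h $ i - l $ i) * u i =
      Const ((h $ i - l $ i) * (1 / (h $ i - l $ i))) * (Var i - Const (l $ i))" for i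
    by (simp only: u_def Const_mult mult.assoc)
  then have Var: "Var i = Const (l $ i) + Const (h $ i - l $ i) * u i" for i
    using nz[of i] by simp
  have "finite (\<Union>\<mu>\<in>Poly_Mapping.keys q. range (Poly_Mapping.lookup \<mu>))"
    by simp
  then obtain N0 where N0: "\<And>\<mu> i. \<mu> \<in> Poly_Mapping.keys q \<Longrightarrow> Poly_Mapping.lookup \<mu> i \<le> N0"
    unfolding finite_nat_set_iff_bounded_le by blast
  obtain N where "N0 \<le> N" and nonneg: "\<And>\<kappa>. \<forall>i. \<kappa> i \<le> N \<Longrightarrow> 0 \<le> box_Bernstein_coeff l h q N \<kappa>"
    using box_Bernstein_coeff_nonneg[OF less_imp_le[OF lh] pos, of N0] by blast
  have "u i \<in> preprime G" "v i \<in> preprime G" for i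
    using lh[of i] lower upper by (auto simp: u_def v_def intro!: preprime.mult preprime.Const)
  then have "(\<Sum>\<kappa>\<in>UNIV \<rightarrow>\<^sub>E {..N}. Const (box_Bernstein_coeff l h q N \<kappa>) *
      (\<Prod>i\<in>UNIV. Const (real (N choose \<kappa> i)) * u i ^ \<kappa> i * v i ^ (N - \<kappa> i))) \<in> preprime G"
    by (intro preprime_sum preprime_prod preprime.mult preprime_power preprime.Const nonneg) auto
  moreover have "\<mu> \<in> Poly_Mapping.keys q \<Longrightarrow> Poly_Mapping.lookup \<mu> i \<le> N" for \<mu> i
    using N0 \<open>N0 \<le> N\<close> order_trans by blast
  ultimately show ?thesis
    using box_Bernstein_expansion[OF uv Var, of q N] by simp
qed

section \<open>From the feasible set to a box\<close>

text \<open>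
  If \<open>f + n F\<close> takes a nonpositive value at \<open>x n\<close> for every \<open>n\<close>, then a limit point \<open>y\<close> of these points has
  \<open>f y \<le> 0\<close>, and after division by \<open>n\<close> also \<open>F y \<le> 0\<close>.
  Then \<open>F\<close> vanishes at \<open>y\<close>, where \<open>f\<close> is positive.
\<close>

lemma exists_multiple_pos_on_compact:
  fixes f F :: "'a::metric_space \<Rightarrow> real"
  assumes "compact B" "continuous_on B f" "continuous_on B F"
    and nonneg: "\<And>x. x \<in> B \<Longrightarrow> 0 \<le> F x"
    and pos: "\<And>x. x \<in> B \<Longrightarrow> F x = 0 \<Longrightarrow> 0 < f x"
  shows "\<exists>M\<ge>0. \<forall>x\<in>B. 0 < f x + M * F x"
proof (rule ccontr)
  assume contra: "\<not> ?thesis"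
  have "\<exists>x\<in>B. f x + real n * F x \<le> 0" for n
    using contra by (meson not_le of_nat_0_le_iff)
  then obtain x where x: "\<And>n. x n \<in> B" and le: "\<And>n. f (x n) + real n * F (x n) \<le> 0"
    by metis
  obtain y s where y: "y \<in> B" and s: "strict_mono s" and lim: "(x \<circ> s) \<longlonglongrightarrow> y"
    using \<open>compact B\<close> x unfolding compact_def by metis
  have f: "(\<lambda>n. f (x (s n))) \<longlonglongrightarrow> f y" and F: "(\<lambda>n. F (x (s n))) \<longlonglongrightarrow> F y"
    using x by (intro continuous_on_tendsto_compose[OF _ lim[unfolded o_def] y]
      assms always_eventually allI; simp)+
  have "f (x n) \<le> 0" for n
    using le[of n] nonneg[OF x[of n]] by (smt (verit) mult_nonneg_nonneg of_nat_0_le_iff)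
  then have "f y \<le> 0"
    by (intro tendsto_upperbound[OF f]) auto
  have inv: "(\<lambda>n. inverse (real (s n))) \<longlonglongrightarrow> 0"
    using LIMSEQ_subseq_LIMSEQ[OF lim_inverse_n s] by (simp add: o_def)
  have "(\<lambda>n. f (x (s n)) * inverse (real (s n)) + F (x (s n))) \<longlonglongrightarrow> f y * 0 + F y"
    by (intro tendsto_intros f F inv)
  moreover have "f (x n) * inverse (real n) + F (x n) \<le> 0" if "0 < n" for n
    using le[of n] that by (simp add: field_simps)
  then have "\<forall>\<^sub>F n in sequentially. f (x (s n)) * inverse (real (s n)) + F (x (s n)) \<le> 0"
    using s by (intro eventually_sequentiallyI[of 1]) (metis le_trans less_le_trans seq_suble zero_less_one)
  ultimately have "f y * 0 + F y \<le> 0"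
    by (rule tendsto_upperbound) simp
  then have "F y = 0"
    using nonneg[OF y] by simp
  with pos[OF y] \<open>f y \<le> 0\<close> show False
    by simp
qed

text \<open>
  The ideal multiplier of \<open>g j\<close> is large where the constraint is violated and zero where it holds; up to a
  perturbation it is \<open>M\<close> times the negative part of \<open>g j\<close>. The perturbation by \<open>\<epsilon>\<close> leaves room for the
  approximation by polynomials.
\<close>

lemma exists_positive_multipliers:
  fixes g :: "'m::finite \<Rightarrow> 'n::finite rpoly" and B :: "(real ^ 'n) set"
  assumes "compact B"
    and pos: "\<And>x. x \<in> B \<Longrightarrow> x \<in> feasible_set g \<Longrightarrow> 0 < peval p x"
  shows "\<exists>h. (\<forall>j. \<forall>x\<in>B. 0 < peval (h j) x) \<and> (\<forall>x\<in>B. 0 < peval (p - (\<Sum>j\<in>UNIV. h j * g j)) x)"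
proof -
  define viol where "viol j x = max 0 (- peval (g j) x)" for j x
  define F where "F x = (\<Sum>j\<in>UNIV. (viol j x)\<^sup>2)" for x
  have cont: "continuous_on B (viol j)" "continuous_on B F" for j
    unfolding viol_def F_def by (intro continuous_intros)+
  have zero: "x \<in> feasible_set g" if "F x = 0" for x
  proof -
    have "max 0 (- peval (g j) x) = 0" for j
      using that by (simp add: F_def viol_def sum_nonneg_eq_0_iff)
    then have "0 \<le> peval (g j) x" for j
      by (metis max.absorb_iff1 neg_le_0_iff_le)
    then show ?thesis
      by (simp add: feasible_set_def)
  qed
  have "\<exists>M\<ge>0. \<forall>x\<in>B. 0 < peval p x + M * F x"
    by (rule exists_multiple_pos_on_compact)
      (use \<open>compact B\<close> cont pos zero in \<open>auto simp: continuous_on_peval F_def intro: sum_nonneg\<close>)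
  then obtain M where "0 \<le> M" and M: "\<And>x. x \<in> B \<Longrightarrow> 0 < peval p x + M * F x"
    by blast
  obtain \<eta> where "0 < \<eta>" and \<eta>: "\<And>x. x \<in> B \<Longrightarrow> \<eta> \<le> peval p x + M * F x"
  proof (cases "B = {}")
    case False
    have "continuous_on B (\<lambda>x. peval p x + M * F x)"
      by (intro continuous_intros cont)
    from continuous_attains_inf[OF \<open>compact B\<close> False this] obtain x\<^sub>0
      where "x\<^sub>0 \<in> B" "\<And>x. x \<in> B \<Longrightarrow> peval p x\<^sub>0 + M * F x\<^sub>0 \<le> peval p x + M * F x"
      by blast
    then show ?thesis
      by (intro that[of "peval p x\<^sub>0 + M * F x\<^sub>0"] M)
  next
    case True
    then show ?thesis
      by (intro that[of 1]) simp_all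
  qed
  obtain C where "0 \<le> C" and C: "\<And>x. x \<in> B \<Longrightarrow> (\<Sum>j\<in>UNIV. \<bar>peval (g j) x\<bar>) \<le> C"
  proof -
    let ?s = "\<lambda>x. \<Sum>j\<in>UNIV. \<bar>peval (g j) x\<bar>"
    have "bounded (?s ` B)"
      by (intro compact_imp_bounded compact_continuous_image \<open>compact B\<close> continuous_intros)
    then obtain C where "\<forall>y\<in>?s ` B. norm y \<le> C"
      unfolding bounded_iff by (rule exE)
    then have "?s x \<le> max 0 C" if "x \<in> B" for x
      using that by fastforce
    then show ?thesis
      by (intro that[of "max 0 C"]) simp_all
  qed
  \<comment> \<open>A multiplier ends up within \<open>2 * \<epsilon>\<close> of \<open>M * viol j\<close>: \<open>\<epsilon>\<close> by the shift, \<open>\<epsilon>\<close> by the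
    approximation. This costs at most \<open>2 * \<epsilon> * C\<close> of the margin \<open>\<eta>\<close>.\<close>
  define \<epsilon> where "\<epsilon> = \<eta> / (2 * C + 1)"
  have "0 < \<epsilon>" "2 * \<epsilon> * C < \<eta>"
    using \<open>0 < \<eta>\<close> \<open>0 \<le> C\<close> by (auto simp: \<epsilon>_def field_simps)
  have "\<exists>q. \<forall>x\<in>B. \<bar>\<epsilon> + M * viol j x - peval q x\<bar> < \<epsilon>" for j
  proof -
    have "continuous_on B (\<lambda>x. \<epsilon> + M * viol j x)"
      by (intro continuous_intros cont)
    from Stone_Weierstrass_real_polynomial_function[OF \<open>compact B\<close> this \<open>0 < \<epsilon>\<close>]
    obtain f where f: "real_polynomial_function f" "\<And>x. x \<in> B \<Longrightarrow> \<bar>\<epsilon> + M * viol j x - f x\<bar> < \<epsilon>"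
      by blast
    from real_polynomial_function_eq_peval[OF f(1)] obtain q where "f = peval q" ..
    with f(2) show ?thesis by blast
  qed
  then obtain h where h: "\<And>j x. x \<in> B \<Longrightarrow> \<bar>\<epsilon> + M * viol j x - peval (h j) x\<bar> < \<epsilon>"
    by metis
  have "0 < peval (h j) x" if "x \<in> B" for j x
  proof -
    have "0 \<le> M * viol j x"
      using \<open>0 \<le> M\<close> by (simp add: viol_def)
    then show ?thesis
      using h[OF that, of j] by linarith
  qed
  moreover have "0 < peval (p - (\<Sum>j\<in>UNIV. h j * g j)) x" if "x \<in> B" for x
  proof -
    have "peval (h j) x * peval (g j) x \<le> 2 * \<epsilon> * \<bar>peval (g j) x\<bar> - M * (viol j x)\<^sup>2" for j
    proof -
      have "viol j x * peval (g j) x = - (viol j x)\<^sup>2"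
        by (simp add: viol_def max_def power2_eq_square)
      then have "peval (h j) x * peval (g j) x =
          (peval (h j) x - M * viol j x) * peval (g j) x - M * (viol j x)\<^sup>2"
        by (simp add: algebra_simps)
      moreover have "(peval (h j) x - M * viol j x) * peval (g j) x \<le> 2 * \<epsilon> * \<bar>peval (g j) x\<bar>"
      proof -
        have "\<bar>peval (h j) x - M * viol j x\<bar> \<le> 2 * \<epsilon>"
          using h[OF that, of j] by linarith
        then have "\<bar>(peval (h j) x - M * viol j x) * peval (g j) x\<bar> \<le> 2 * \<epsilon> * \<bar>peval (g j) x\<bar>"
          by (simp add: abs_mult mult_right_mono)
        then show ?thesis by linarith
      qed
      ultimately show ?thesis by simp
    qed
    then have "(\<Sum>j\<in>UNIV. peval (h j) x * peval (g j) x) \<le>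
        (\<Sum>j\<in>UNIV. 2 * \<epsilon> * \<bar>peval (g j) x\<bar> - M * (viol j x)\<^sup>2)"
      by (intro sum_mono)
    also have "\<dots> = 2 * \<epsilon> * (\<Sum>j\<in>UNIV. \<bar>peval (g j) x\<bar>) - M * F x"
      by (simp add: F_def sum_subtractf sum_distrib_left)
    also have "2 * \<epsilon> * (\<Sum>j\<in>UNIV. \<bar>peval (g j) x\<bar>) \<le> 2 * \<epsilon> * C"
      using C[OF that] \<open>0 < \<epsilon>\<close> by simp
    finally show ?thesis
      using \<eta>[OF that] \<open>2 * \<epsilon> * C < \<eta>\<close> by (simp add: peval_diff peval_sum peval_mult)
  qed
  ultimately show ?thesis by blast
qed

lemma preprime_if_pos_on_feasible_set:
  fixes g :: "'m::finite \<Rightarrow> 'n::finite rpoly" and L U :: "real ^ 'n"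
  assumes "\<And>i. L $ i \<le> U $ i"
    and pos: "\<And>x. x \<in> feasible_set g \<Longrightarrow> 0 < peval p x"
  shows "p \<in> preprime (range (\<lambda>i. Var i - Const (L $ i)) \<union> range (\<lambda>i. Const (U $ i) - Var i) \<union> range g)"
    (is "p \<in> preprime ?G")
proof -
  \<comment> \<open>The wider box is nondegenerate, and its linear polynomials still lie in the preprime.\<close>
  define l h where "l = L - 1" and "h = U + 1"
  have lower: "Var i - Const (l $ i) \<in> preprime ?G" for i
  proof -
    have "Var i - Const (l $ i) = (Var i - Const (L $ i)) + Const 1"
      by (simp add: l_def Const_diff)
    moreover have "\<dots> \<in> preprime ?G"
      by (intro preprime.add preprime.gen preprime.Const) auto
    ultimately show ?thesis
      by (simp only:)
  qed
  have upper: "Const (h $ i) - Var i \<in> preprime ?G" for i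
  proof -
    have "Const (h $ i) - Var i = (Const (U $ i) - Var i) + Const 1"
      by (simp add: h_def Const_add)
    moreover have "\<dots> \<in> preprime ?G"
      by (intro preprime.add preprime.gen preprime.Const) auto
    ultimately show ?thesis
      by (simp only:)
  qed
  have lh: "l $ i < h $ i" for i
    using assms(1)[of i] by (simp add: l_def h_def)
  have "\<exists>m. (\<forall>j. \<forall>x\<in>cbox l h. 0 < peval (m j) x) \<and>
      (\<forall>x\<in>cbox l h. 0 < peval (p - (\<Sum>j\<in>UNIV. m j * g j)) x)"
    by (intro exists_positive_multipliers compact_cbox pos)
  then obtain m where m: "\<And>j x. x \<in> cbox l h \<Longrightarrow> 0 < peval (m j) x"
    and rest: "\<And>x. x \<in> cbox l h \<Longrightarrow> 0 < peval (p - (\<Sum>j\<in>UNIV. m j * g j)) x"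
    by blast
  note box = preprime_if_pos_on_box[OF lh lower upper]
  have "(p - (\<Sum>j\<in>UNIV. m j * g j)) + (\<Sum>j\<in>UNIV. m j * g j) \<in> preprime ?G"
    by (intro preprime.add preprime_sum preprime.mult box rest m preprime.gen) auto
  then show ?thesis by simp
qed

section \<open>The normal form of preprime elements\<close>

definition generator_monomial ::
  "('n::finite \<Rightarrow> 'n rpoly) \<Rightarrow> ('n \<Rightarrow> 'n rpoly) \<Rightarrow> ('m::finite \<Rightarrow> 'n rpoly) \<Rightarrow>
    (nat ^ 'n) \<times> (nat ^ 'n) \<times> (nat ^ 'm) \<Rightarrow> 'n rpoly"
  where "generator_monomial a b g = (\<lambda>(\<alpha>, \<beta>, \<gamma>). mpow a \<alpha> * mpow b \<beta> * mpow g \<gamma>)"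

lemma mpow_add: "mpow f (\<alpha> + \<beta>) = mpow f \<alpha> * mpow f \<beta>"
  by (simp add: mpow_def power_add prod.distrib)

lemma mpow_0 [simp]: "mpow f 0 = 1"
  by (simp add: mpow_def)

lemma mpow_axis: "mpow f (axis i 1) = f i"
proof -
  have "mpow f (axis i 1) = (\<Prod>j\<in>UNIV. if j = i then f j else 1)"
    unfolding mpow_def by (intro prod.cong) (auto simp: axis_def)
  then show ?thesis by simp
qed

lemma generator_monomial_add:
  "generator_monomial a b g (d + e) = generator_monomial a b g d * generator_monomial a b g e"
  by (cases d; cases e) (simp add: generator_monomial_def mpow_add algebra_simps)

text \<open>
  An intermediate form of the elements of a preprime in which the number of summands is not
  recorded: closure under products becomes a double induction over single terms, without any
  manipulation of index sets.
\<close>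

inductive nonneg_combination :: "('e \<Rightarrow> 'n rpoly) \<Rightarrow> 'n rpoly \<Rightarrow> bool" for M where
  monomial: "0 \<le> c \<Longrightarrow> nonneg_combination M (Const c * M e)"
| add: "nonneg_combination M q \<Longrightarrow> nonneg_combination M q' \<Longrightarrow> nonneg_combination M (q + q')"

lemma nonneg_combination_mult:
  fixes M :: "'e::plus \<Rightarrow> 'n rpoly"
  assumes hom: "\<And>d e. M (d + e) = M d * M e"
    and "nonneg_combination M q" "nonneg_combination M q'"
  shows "nonneg_combination M (q * q')"
  using assms(2)
proof induction
  case (monomial c d)
  have c: "0 \<le> c" by fact
  from assms(3) show ?case
  proof induction
    case (monomial c' e)
    have "Const c * M d * (Const c' * M e) = Const (c * c') * M (d + e)"
      by (simp add: hom Const_mult algebra_simps)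
    then show ?case
      using c monomial by (metis mult_nonneg_nonneg nonneg_combination.monomial)
  qed (auto simp: distrib_left intro: nonneg_combination.add)
qed (auto simp: distrib_right intro: nonneg_combination.add)

lemma preprime_nonneg_combination:
  assumes "q \<in> preprime (range a \<union> range b \<union> range g)"
  shows "nonneg_combination (generator_monomial a b g) q"
  using assms
proof induction
  case (Const c)
  have "generator_monomial a b g 0 = 1"
    by (simp add: generator_monomial_def zero_prod_def)
  then show ?case
    using Const nonneg_combination.monomial[of c "generator_monomial a b g" 0] by simp
next
  case (gen q)
  have "generator_monomial a b g (axis i 1, 0, 0) = a i" "generator_monomial a b g (0, axis i 1, 0) = b i"
    "generator_monomial a b g (0, 0, axis j 1) = g j" for i j
    by (simp_all add: generator_monomial_def mpow_axis[unfolded One_nat_def])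
  moreover have "nonneg_combination (generator_monomial a b g) (generator_monomial a b g e)" for e
    using nonneg_combination.monomial[of 1 "generator_monomial a b g" e] by simp
  ultimately show ?case
    using gen by (smt (verit) UnE rangeE)
next
  case (mult q q')
  then show ?case
    by (blast intro: nonneg_combination_mult generator_monomial_add)
qed (rule nonneg_combination.add)

text \<open>
  The coefficients have finite support, so every sufficiently large degree bound gives the same
  sum. Claiming this for all \<open>s \<ge> r\<close> lets two sums with different bounds be added.
\<close>

lemma nonneg_combination_exponents:
  fixes M :: "(nat ^ 'n) \<times> (nat ^ 'n) \<times> (nat ^ 'm::finite) \<Rightarrow> 'n::finite rpoly"
  assumes "nonneg_combination M q"
  shows "\<exists>r c. (\<forall>e. 0 \<le> c e) \<and> (\<forall>s\<ge>r. q = (\<Sum>e\<in>exponents s. Const (c e) * M e))"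
  using assms
proof induction
  case (monomial c e)
  obtain \<alpha> \<beta> \<gamma> where e: "e = (\<alpha>, \<beta>, \<gamma>)"
    by (cases e)
  define r where "r = (\<Sum>i\<in>UNIV. \<alpha> $ i) + (\<Sum>i\<in>UNIV. \<beta> $ i) + (\<Sum>j\<in>UNIV. \<gamma> $ j)"
  have "Const c * M e = (\<Sum>d\<in>exponents s. Const (if d = e then c else 0) * M d)" if "r \<le> s" for s
  proof -
    have "e \<in> exponents s"
      using that by (simp add: exponents_def e r_def)
    have "(\<Sum>d\<in>exponents s. Const (if d = e then c else 0) * M d) =
        (\<Sum>d\<in>exponents s. if d = e then Const c * M d else 0)"
      by (intro sum.cong) auto
    also have "\<dots> = Const c * M e"
      using \<open>e \<in> exponents s\<close> by (simp add: finite_exponents)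
    finally show ?thesis by simp
  qed
  with monomial show ?case
    by (intro exI[of _ r] exI[of _ "\<lambda>d. if d = e then c else 0"]) auto
next
  case (add q q')
  then obtain r c r' c' where
    "\<forall>e. 0 \<le> c e" "\<forall>s\<ge>r. q = (\<Sum>e\<in>exponents s. Const (c e) * M e)"
    "\<forall>e. 0 \<le> c' e" "\<forall>s\<ge>r'. q' = (\<Sum>e\<in>exponents s. Const (c' e) * M e)"
    by blast
  then have "\<forall>e. 0 \<le> c e + c' e" and
    "\<forall>s\<ge>max r r'. q + q' = (\<Sum>e\<in>exponents s. Const (c e + c' e) * M e)"
    by (auto simp: Const_add distrib_right sum.distrib)
  then show ?case by (intro exI[of _ "max r r'"] exI[of _ "\<lambda>e. c e + c' e"]) blast
qed

section \<open>The representation theorem\<close>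

theorem proposition3:
  fixes \<K> :: "('n::finite) rpoly set"
    and g :: "'m::finite \<Rightarrow> 'n rpoly"
    and L U :: "real ^ 'n"
    and p :: "'n rpoly"
  assumes "Const ` {0..} \<subseteq> \<K>"
    and "feasible_set g \<noteq> {}"
    and "compact (feasible_set g)"
    and "feasible_set g \<subseteq> {x. L \<le> x \<and> x \<le> U}"
    and "\<And>x. x \<in> feasible_set g \<Longrightarrow> peval p x > 0"
  shows "\<exists>(r::nat) (c :: (nat ^ 'n) \<times> (nat ^ 'n) \<times> (nat ^ 'm) \<Rightarrow> 'n rpoly).
    (\<forall>(\<alpha>, \<beta>, \<gamma>) \<in> exponents r. c (\<alpha>, \<beta>, \<gamma>) \<in> \<K>) \<and>
    p = (\<Sum>(\<alpha>, \<beta>, \<gamma>) \<in> exponents r.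
          c (\<alpha>, \<beta>, \<gamma>) * mpow (\<lambda>i. Var i - Const (L $ i)) \<alpha>
            * mpow (\<lambda>i. Const (U $ i) - Var i) \<beta> * mpow g \<gamma>)"
proof -
  obtain x where "L \<le> x" "x \<le> U"
    using assms(2,4) by blast
  then have "L $ i \<le> U $ i" for i
    unfolding less_eq_vec_def using order_trans by blast
  then have comb: "nonneg_combination
      (generator_monomial (\<lambda>i. Var i - Const (L $ i)) (\<lambda>i. Const (U $ i) - Var i) g) p"
    using assms(5) by (intro preprime_nonneg_combination preprime_if_pos_on_feasible_set)
  then obtain r c where "\<And>e. 0 \<le> c e"
    and "p = (\<Sum>e\<in>exponents r. Const (c e) *
      generator_monomial (\<lambda>i. Var i - Const (L $ i)) (\<lambda>i. Const (U $ i) - Var i) g e)"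
    using nonneg_combination_exponents[OF comb] order_refl by blast
  moreover have "Const (c e) \<in> \<K>" for e
    using assms(1) \<open>0 \<le> c e\<close> by auto
  ultimately show ?thesis
    by (intro exI[of _ r] exI[of _ "\<lambda>e. Const (c e)"])
      (simp add: generator_monomial_def case_prod_unfold mult.assoc)
qed

end
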